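(* Let $(\mathcal N_p)_{p\ge 1}$ be a sequence of measurable partitions of $[0,1]^d$, where $\mathcal N_p=(\Omega_{k,p})_{1\le k\le K_p}$ has $K_p$ strata and $w_{k,p}$ denotes the Lebesgue measure of $\Omega_{k,p}$, such that: (AS1) $0<w_{k,p}\le \upsilon_p$ for all $k\le K_p$ and all $p$, for some sequence $(\upsilon_p)_p$ with $\upsilon_p\to 0$ as $p\to+\infty$; (AS2) there is a real-valued function $D(\cdot)$ with $D(w)\to 0$ as $w\to 0$ such that the diameters of the strata for the Euclidean norm $\|\cdot\|_2$ on $\mathbb R^d$ satisfy $\mathrm{Diam}(\Omega_{k,p})\le D(w_{k,p})$ for all $k\le K_p$ and all $p$. If the functions $f$ and $s$ are in $\mathbb L_2([0,1]^d)$, then $$\lim_{p\to+\infty}\Sigma_{\mathcal N_p}=\inf_{\mathcal N\ \text{measurable}}\Sigma_{\mathcal N}=\int_{[0,1]^d}s(x)\,dx,$$ which implies that $n\times Q_{n,\mathcal N_p}\to 0$ as $p\to+\infty$.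
   Context: Model: $f:[0,1]^d\to\mathbb R$ and $s:[0,1]^d\to[0,\infty)$ are functions; querying a point $x\in[0,1]^d$ returns $f(x)+s(x)\epsilon$, where $\epsilon$ is an independent sample from a distribution $\nu_x$ with mean $0$ and variance $1$ (its shape may depend on $x$). A (measurable) partition $\mathcal N$ of $[0,1]^d$ consists of $K$ Lebesgue measurable strata $\Omega_1,\dots,\Omega_K$ ($K$ finite, arbitrary) of positive Lebesgue measures $w_1,\dots,w_K$. For each stratum, $\mu_k=\frac1{w_k}\int_{\Omega_k}f(x)\,dx$ and $\sigma_k^2=\frac1{w_k}\int_{\Omega_k}\mathbb E_{\epsilon\sim\nu_x}\big[(f(x)+s(x)\epsilon-\mu_k)^2\big]dx$ are the mean and variance of a noisy sample taken at a uniformly random point of $\Omega_k$. $\Sigma_{\mathcal N}=\sum_{k\le K}w_k\sigma_k$. For a budget of $n$ samples, the optimal oracle pseudo-risk on $\mathcal N$ is $L_{n,\mathcal N}(\mathcal A^* )=\Sigma_{\mathcal N}^2/n$, and the quality of the partition is $Q_{n,\mathcal N}=L_{n,\mathcal N}(\mathcal A^* )-\inf_{\mathcal N'\ \text{measurable}}L_{n,\mathcal N'}(\mathcal A^* )$, the infimum being over all measurable partitions with an arbitrary number of strata. *)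

theory Defs
  imports "HOL-Probability.Probability"
begin

definition unit_cube :: "(real ^ 'd) set" where
  "unit_cube = cbox 0 1"

definition standardized :: "real measure \<Rightarrow> bool" where
  "standardized M \<longleftrightarrow>
     prob_space M \<and> sets M = sets borel \<and>
     integrable M (\<lambda>e. e) \<and> integrable M (\<lambda>e. e\<^sup>2) \<and>
     prob_space.expectation M (\<lambda>e. e) = 0 \<and> prob_space.variance M (\<lambda>e. e) = 1"

definition L2_on_cube :: "(real ^ 'd \<Rightarrow> real) \<Rightarrow> bool" where
  "L2_on_cube g \<longleftrightarrow>
     g \<in> borel_measurable (lebesgue_on unit_cube) \<and>
     integrable (lebesgue_on unit_cube) (\<lambda>x. (g x)\<^sup>2)"

text \<open>A partition is represented by the set of its strata. Nothing is lost compared to a family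
  indexed by \<open>1, \<dots>, K\<close>: the strata are nonempty and disjoint, hence pairwise
  distinct, and \<open>K\<close> is the cardinality of the set.\<close>

definition measurable_partition :: "(real ^ 'd) set set \<Rightarrow> bool" where
  "measurable_partition P \<longleftrightarrow>
     finite P \<and> partition_on unit_cube P \<and>
     (\<forall>\<Omega>\<in>P. \<Omega> \<in> sets lebesgue \<and> 0 < measure lebesgue \<Omega>)"

definition stratum_mean :: "(real ^ 'd \<Rightarrow> real) \<Rightarrow> (real ^ 'd) set \<Rightarrow> real" where
  "stratum_mean f \<Omega> = (LINT x:\<Omega>|lebesgue. f x) / measure lebesgue \<Omega>"

definition stratum_variance ::
  "(real ^ 'd \<Rightarrow> real) \<Rightarrow> (real ^ 'd \<Rightarrow> real) \<Rightarrow> (real ^ 'd \<Rightarrow> real measure) \<Rightarrow>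
     (real ^ 'd) set \<Rightarrow> real" where
  "stratum_variance f s \<nu> \<Omega> =
     (LINT x:\<Omega>|lebesgue. (LINT e|\<nu> x. (f x + s x * e - stratum_mean f \<Omega>)\<^sup>2))
       / measure lebesgue \<Omega>"

definition Sigma_part ::
  "(real ^ 'd \<Rightarrow> real) \<Rightarrow> (real ^ 'd \<Rightarrow> real) \<Rightarrow> (real ^ 'd \<Rightarrow> real measure) \<Rightarrow>
     (real ^ 'd) set set \<Rightarrow> real" where
  "Sigma_part f s \<nu> P = (\<Sum>\<Omega>\<in>P. measure lebesgue \<Omega> * sqrt (stratum_variance f s \<nu> \<Omega>))"

definition oracle_risk ::
  "(real ^ 'd \<Rightarrow> real) \<Rightarrow> (real ^ 'd \<Rightarrow> real) \<Rightarrow> (real ^ 'd \<Rightarrow> real measure) \<Rightarrow>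
     nat \<Rightarrow> (real ^ 'd) set set \<Rightarrow> real" where
  "oracle_risk f s \<nu> n P = (Sigma_part f s \<nu> P)\<^sup>2 / real n"

text \<open>The real infima over all measurable partitions, here and for \<open>Sigma_part\<close>, are genuine: the
  one-stratum partition is a measurable partition, and both quantities are nonnegative.\<close>

definition partition_quality ::
  "(real ^ 'd \<Rightarrow> real) \<Rightarrow> (real ^ 'd \<Rightarrow> real) \<Rightarrow> (real ^ 'd \<Rightarrow> real measure) \<Rightarrow>
     nat \<Rightarrow> (real ^ 'd) set set \<Rightarrow> real" where
  "partition_quality f s \<nu> n P =
     oracle_risk f s \<nu> n P - (INF P'\<in>{P'. measurable_partition P'}. oracle_risk f s \<nu> n P')"

end

theory Submission
  imports Defs
begin

text \<open>Fix a partition and write, for a stratum of weight \<open>w\<close>, \<open>m\<close> for the mean of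
  \<open>s\<close> and \<open>V\<close> for the sum of the two integrals of the squared deviations of
  \<open>f\<close> and \<open>s\<close> from their means on the stratum. As the noise is centred with unit
  variance, the sampling variance is \<open>m\<^sup>2 + V / w\<close>
  (\<open>stratum_variance_decomposition\<close>): the squared mean noise level plus the heterogeneity of
  \<open>f\<close> and \<open>s\<close>. Hence the contribution \<open>w * sqrt (m\<^sup>2 + V / w)\<close> of the
  stratum lies between \<open>m * w\<close>, the integral of \<open>s\<close> over it, and
  \<open>m * w + sqrt w * sqrt V\<close>. Summing, and using Cauchy-Schwarz together with the fact that the
  weights add up to 1, the sum \<open>\<Sigma>\<close> of these contributions is at least the integral of
  \<open>s\<close> for every partition, and exceeds it by at most the square root of the total deviation
  (\<open>Sigma_part_bounds\<close>).

  Only the vanishing of the total deviation of an L2 function along partitions of vanishing mesh is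
  left (\<open>sum_stratum_deviation_tendsto_0\<close>). For a continuous function it follows from uniform
  continuity on the compact cube. In general the function is replaced by a continuous one that is
  close in L2 (\<open>continuous_approximation_L2\<close>); the cost does not depend on the partition,
  since on each stratum the mean is the best constant approximation.

  The mesh vanishes because the weights of the strata tend to zero uniformly and control their
  diameters. The given sequence of partitions then shows that the lower bound is the infimum, for
  \<open>\<Sigma>\<close> and, as \<open>\<Sigma>\<close> is bounded below by a nonnegative number, equally for the
  pseudo-risk \<open>\<Sigma>\<^sup>2 / n\<close>.\<close>

section \<open>Square-integrable functions on a finite measure space\<close>

context finite_measure
begin

lemma integrable_square_diff:
  fixes g h :: "'a \<Rightarrow> real"
  assumes [measurable]: "g \<in> borel_measurable M" "h \<in> borel_measurable M"
    and g2: "integrable M (\<lambda>x. (g x)\<^sup>2)" and h2: "integrable M (\<lambda>x. (h x)\<^sup>2)"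
  shows "integrable M (\<lambda>x. (g x - h x)\<^sup>2)"
proof (rule Bochner_Integration.integrable_bound)
  show "integrable M (\<lambda>x. 2 * (g x)\<^sup>2 + 2 * (h x)\<^sup>2)" using g2 h2 by simp
  have "(g x - h x)\<^sup>2 \<le> 2 * (g x)\<^sup>2 + 2 * (h x)\<^sup>2" for x
    using zero_le_power2[of "g x + h x"] by (simp add: power2_sum power2_diff)
  then show "AE x in M. norm ((g x - h x)\<^sup>2) \<le> norm (2 * (g x)\<^sup>2 + 2 * (h x)\<^sup>2)"
    by simp
qed measurable

lemma integral_square_diff_triangle:
  fixes f g h :: "'a \<Rightarrow> real"
  assumes fg: "integrable M (\<lambda>x. (f x - g x)\<^sup>2)" and gh: "integrable M (\<lambda>x. (g x - h x)\<^sup>2)"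
    and fh: "integrable M (\<lambda>x. (f x - h x)\<^sup>2)"
  shows "(LINT x|M. (f x - h x)\<^sup>2)
           \<le> 2 * (LINT x|M. (f x - g x)\<^sup>2) + 2 * (LINT x|M. (g x - h x)\<^sup>2)"
proof -
  have "(f x - h x)\<^sup>2 \<le> 2 * (f x - g x)\<^sup>2 + 2 * (g x - h x)\<^sup>2" for x
    using zero_le_power2[of "(f x - g x) - (g x - h x)"] by (simp add: power2_eq_square algebra_simps)
  then have "(LINT x|M. (f x - h x)\<^sup>2) \<le> (LINT x|M. 2 * (f x - g x)\<^sup>2 + 2 * (g x - h x)\<^sup>2)"
    using fg gh fh by (intro integral_mono) auto
  then show ?thesis using fg gh by simp
qed

lemma integral_square_deviation:
  fixes g :: "'a \<Rightarrow> real"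
  assumes g: "g \<in> borel_measurable M" and g2: "integrable M (\<lambda>x. (g x)\<^sup>2)"
  shows "(LINT x|M. (g x - c)\<^sup>2)
           = (LINT x|M. (g x)\<^sup>2) - 2 * c * (LINT x|M. g x) + c\<^sup>2 * measure M (space M)"
proof -
  have "integrable M g" using square_integrable_imp_integrable[OF g g2] .
  then show ?thesis using g2 by (simp add: power2_diff mult_ac)
qed

text \<open>Expanding the squares, this is the bias-variance identity. It is used twice: it says that
  the mean is the best constant approximation, and at \<open>c = 0\<close> it splits the second moment into
  deviation and squared mean.\<close>

lemma integral_square_deviation_from_mean:
  fixes g :: "'a \<Rightarrow> real"
  assumes g: "g \<in> borel_measurable M" and g2: "integrable M (\<lambda>x. (g x)\<^sup>2)"
    and m: "m * measure M (space M) = (LINT x|M. g x)"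
  shows "(LINT x|M. (g x - c)\<^sup>2)
           = (LINT x|M. (g x - m)\<^sup>2) + (m - c)\<^sup>2 * measure M (space M)"
  unfolding integral_square_deviation[OF g g2] m[symmetric]
  by (simp add: power2_eq_square algebra_simps)

end

section \<open>Density of continuous functions in L2\<close>

text \<open>A measurable function is an almost everywhere limit of continuous functions, but without a
  common bound. Clamping repairs this: \<open>f\<close> is close in L2 to its clamped version, which is the
  limit of the clamped continuous functions, and dominated convergence applies to both
  approximations.\<close>

lemma continuous_approximation_L2:
  fixes f :: "'a::euclidean_space \<Rightarrow> real"
  assumes S: "S \<in> lmeasurable" and f: "f \<in> borel_measurable (lebesgue_on S)"
    and f2: "integrable (lebesgue_on S) (\<lambda>x. (f x)\<^sup>2)" and "0 < \<epsilon>"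
  obtains g where "continuous_on UNIV g" "integrable (lebesgue_on S) (\<lambda>x. (g x)\<^sup>2)"
    "(LINT x|lebesgue_on S. (f x - g x)\<^sup>2) < \<epsilon>"
proof -
  have Ss: "S \<in> sets lebesgue" using S by blast
  interpret finite_measure "lebesgue_on S" using S by (rule finite_measure_lebesgue_on)
  define cl where "cl m y = max (- real m) (min (real m) y)" for m y
  have cl_bd: "\<bar>cl m y\<bar> \<le> real m" for m y by (auto simp: cl_def)
  have cl_cont: "continuous_on UNIV (cl m)" for m
    unfolding cl_def by (intro continuous_intros)
  have [measurable]: "cl m \<in> borel_measurable borel" for m
    using cl_cont by (rule borel_measurable_continuous_onI)
  note f[measurable]
  have clf2: "integrable (lebesgue_on S) (\<lambda>x. (cl m (h x))\<^sup>2)"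
    if [measurable]: "h \<in> borel_measurable (lebesgue_on S)" for m h
  proof (rule integrable_const_bound[where B="(real m)\<^sup>2"])
    show "AE x in lebesgue_on S. norm ((cl m (h x))\<^sup>2) \<le> (real m)\<^sup>2"
      using cl_bd by (simp add: abs_le_square_iff[symmetric])
  qed measurable
  have "(\<lambda>m. LINT x|lebesgue_on S. (f x - cl m (f x))\<^sup>2) \<longlonglongrightarrow> (LINT x|lebesgue_on S. 0)"
  proof (rule integral_dominated_convergence[where w="\<lambda>x. (f x)\<^sup>2"])
    have "(\<lambda>m. (f x - cl m (f x))\<^sup>2) \<longlonglongrightarrow> 0" for x
    proof (rule tendsto_eventually, rule eventually_sequentiallyI)
      fix m assume "nat \<lceil>\<bar>f x\<bar>\<rceil> \<le> m"
      then have "\<bar>f x\<bar> \<le> real m" by linarith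
      then show "(f x - cl m (f x))\<^sup>2 = 0" by (auto simp: cl_def)
    qed
    then show "AE x in lebesgue_on S. (\<lambda>m. (f x - cl m (f x))\<^sup>2) \<longlonglongrightarrow> 0" by simp
    have "\<bar>f x - cl m (f x)\<bar> \<le> \<bar>f x\<bar>" for m x by (auto simp: cl_def)
    then show "AE x in lebesgue_on S. norm ((f x - cl m (f x))\<^sup>2) \<le> (f x)\<^sup>2" for m
      by (auto intro: abs_le_square_iff[THEN iffD1])
  qed (use f2 in measurable)
  then have "\<forall>\<^sub>F m in sequentially. (LINT x|lebesgue_on S. (f x - cl m (f x))\<^sup>2) < \<epsilon> / 4"
    using \<open>0 < \<epsilon>\<close> by (intro order_tendstoD) auto
  then obtain m where m: "(LINT x|lebesgue_on S. (f x - cl m (f x))\<^sup>2) < \<epsilon> / 4"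
    by (auto simp: eventually_sequentially)
  have "f measurable_on S"
    using f Ss by (simp add: measurable_on_iff_borel_measurable)
  then obtain N g where N: "negligible N" and g: "\<And>n. continuous_on UNIV (g n)"
    and lim: "\<And>x. x \<notin> N \<Longrightarrow> (\<lambda>n. g n x) \<longlonglongrightarrow> (if x \<in> S then f x else 0)"
    unfolding measurable_on_def by blast
  have gm: "h \<in> borel_measurable (lebesgue_on S)" if "continuous_on UNIV h" for h :: "'a \<Rightarrow> real"
    using that Ss by (intro continuous_imp_measurable_on_sets_lebesgue) (auto intro: continuous_on_subset)
  note gm[OF g, measurable]
  have "(\<lambda>n. LINT x|lebesgue_on S. (cl m (f x) - cl m (g n x))\<^sup>2) \<longlonglongrightarrow> (LINT x|lebesgue_on S. 0)"
  proof (rule integral_dominated_convergence[where w="\<lambda>x. (2 * real m)\<^sup>2"])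
    have "AE x in lebesgue. x \<notin> N"
      using N by (intro AE_not_in) (simp add: negligible_iff_null_sets)
    then have "AE x in lebesgue_on S. x \<notin> N"
      using Ss by (auto simp: AE_restrict_space_iff)
    then show "AE x in lebesgue_on S. (\<lambda>n. (cl m (f x) - cl m (g n x))\<^sup>2) \<longlonglongrightarrow> 0"
    proof (rule AE_mp, intro AE_I2 impI)
      fix x assume "x \<in> space (lebesgue_on S)" "x \<notin> N"
      then have "(\<lambda>n. g n x) \<longlonglongrightarrow> f x" using lim[of x] by simp
      then have "(\<lambda>n. cl m (g n x)) \<longlonglongrightarrow> cl m (f x)"
        unfolding cl_def by (intro tendsto_intros)
      then have "(\<lambda>n. (cl m (f x) - cl m (g n x))\<^sup>2) \<longlonglongrightarrow> (cl m (f x) - cl m (f x))\<^sup>2"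
        by (intro tendsto_intros)
      then show "(\<lambda>n. (cl m (f x) - cl m (g n x))\<^sup>2) \<longlonglongrightarrow> 0" by simp
    qed
    have "\<bar>cl m y - cl m z\<bar> \<le> \<bar>2 * real m\<bar>" for y z using cl_bd[of m y] cl_bd[of m z] by linarith
    then show "AE x in lebesgue_on S. norm ((cl m (f x) - cl m (g n x))\<^sup>2) \<le> (2 * real m)\<^sup>2" for n
      unfolding real_norm_def abs_power2 by (intro AE_I2 abs_le_square_iff[THEN iffD1])
  qed measurable
  then have "\<forall>\<^sub>F n in sequentially. (LINT x|lebesgue_on S. (cl m (f x) - cl m (g n x))\<^sup>2) < \<epsilon> / 4"
    using \<open>0 < \<epsilon>\<close> by (intro order_tendstoD) auto
  then obtain n where n: "(LINT x|lebesgue_on S. (cl m (f x) - cl m (g n x))\<^sup>2) < \<epsilon> / 4"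
    by (auto simp: eventually_sequentially)
  show ?thesis
  proof
    show "continuous_on UNIV (\<lambda>x. cl m (g n x))"
      using continuous_on_compose2[OF cl_cont g] by simp
    show "integrable (lebesgue_on S) (\<lambda>x. (cl m (g n x))\<^sup>2)"
      by (rule clf2) measurable
    have "(LINT x|lebesgue_on S. (f x - cl m (g n x))\<^sup>2)
        \<le> 2 * (LINT x|lebesgue_on S. (f x - cl m (f x))\<^sup>2)
          + 2 * (LINT x|lebesgue_on S. (cl m (f x) - cl m (g n x))\<^sup>2)"
      by (intro integral_square_diff_triangle integrable_square_diff clf2 f2; measurable)
    with m n show "(LINT x|lebesgue_on S. (f x - cl m (g n x))\<^sup>2) < \<epsilon>" by linarith
  qed
qed

section \<open>Strata and partitions\<close>

text \<open>The deviation is not divided by the weight of the stratum, so that its sum over a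
  partition is comparable with integrals over the whole cube.\<close>

definition stratum_deviation :: "(real ^ 'd \<Rightarrow> real) \<Rightarrow> (real ^ 'd) set \<Rightarrow> real" where
  "stratum_deviation g \<Omega> = (LINT x|lebesgue_on \<Omega>. (g x - stratum_mean g \<Omega>)\<^sup>2)"

lemma stratum_deviation_nonneg: "0 \<le> stratum_deviation g \<Omega>"
  by (simp add: stratum_deviation_def)

lemma set_integral_eq_lebesgue_on:
  fixes g :: "'a::euclidean_space \<Rightarrow> real"
  assumes "\<Omega> \<in> sets lebesgue"
  shows "(LINT x:\<Omega>|lebesgue. g x) = (LINT x|lebesgue_on \<Omega>. g x)"
  using assms by (simp add: set_lebesgue_integral_def integral_restrict_space)

lemma integrable_lebesgue_on_subset:
  fixes g :: "'a::euclidean_space \<Rightarrow> real"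
  assumes "integrable (lebesgue_on S) g" "\<Omega> \<in> sets lebesgue" "S \<in> sets lebesgue" "\<Omega> \<subseteq> S"
  shows "integrable (lebesgue_on \<Omega>) g"
  using set_integrable_subset[of lebesgue S g \<Omega>] assms
  by (simp add: set_integrable_def integrable_restrict_space)

lemma unit_cube_lmeasurable: "unit_cube \<in> lmeasurable"
  by (simp add: unit_cube_def)

lemma unit_cube_sets_lebesgue: "unit_cube \<in> sets lebesgue"
  using unit_cube_lmeasurable by blast

lemma measure_unit_cube: "measure lebesgue (unit_cube :: (real ^ 'd) set) = 1"
  by (simp add: unit_cube_def content_cbox_if_cart mem_box_cart interval_eq_empty_cart)

lemma L2_on_cube_subset:
  assumes "L2_on_cube g" "\<Omega> \<in> sets lebesgue" "\<Omega> \<subseteq> unit_cube"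
  shows "g \<in> borel_measurable (lebesgue_on \<Omega>)" "integrable (lebesgue_on \<Omega>) (\<lambda>x. (g x)\<^sup>2)"
  using assms unit_cube_lmeasurable
  by (auto simp: L2_on_cube_def intro: measurable_restrict_mono integrable_lebesgue_on_subset)

lemma measurable_partitionD:
  assumes "measurable_partition P" "\<Omega> \<in> P"
  shows "\<Omega> \<in> sets lebesgue" "0 < measure lebesgue \<Omega>" "\<Omega> \<subseteq> unit_cube" "\<Omega> \<noteq> {}"
    "\<Omega> \<in> lmeasurable"
proof -
  show 1: "\<Omega> \<in> sets lebesgue" "0 < measure lebesgue \<Omega>" "\<Omega> \<subseteq> unit_cube" "\<Omega> \<noteq> {}"
    using assms by (auto simp: measurable_partition_def partition_on_def)
  show "\<Omega> \<in> lmeasurable"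
    using bounded_set_imp_lmeasurable[OF _ 1(1)] bounded_subset[OF _ 1(3)]
    by (simp add: unit_cube_def)
qed

lemma sum_integral_partition:
  fixes g :: "real ^ 'd \<Rightarrow> real"
  assumes P: "measurable_partition P" and g: "integrable (lebesgue_on unit_cube) g"
  shows "(\<Sum>\<Omega>\<in>P. LINT x|lebesgue_on \<Omega>. g x) = (LINT x|lebesgue_on unit_cube. g x)"
proof -
  have cube: "unit_cube = (\<Union>\<Omega>\<in>P. \<Omega>)" and fin: "finite P" and disj: "disjoint P"
    using P by (auto simp: measurable_partition_def partition_on_def)
  have "(LINT x:(\<Union>\<Omega>\<in>P. \<Omega>)|lebesgue. g x) = (\<Sum>\<Omega>\<in>P. LINT x:\<Omega>|lebesgue. g x)"
  proof (rule set_integral_finite_Union)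
    show "disjoint_family_on (\<lambda>\<Omega>. \<Omega>) P"
      using disj by (auto simp: disjoint_family_on_def disjoint_def)
    fix \<Omega> assume "\<Omega> \<in> P"
    note D = measurable_partitionD[OF P this]
    show "\<Omega> \<in> sets lebesgue" by fact
    show "set_integrable lebesgue \<Omega> g"
      using integrable_lebesgue_on_subset[OF g D(1) unit_cube_sets_lebesgue D(3)] D(1)
      by (simp add: set_integrable_def integrable_restrict_space)
  qed fact
  then show ?thesis
    unfolding cube[symmetric] using measurable_partitionD(1)[OF P]
    by (simp add: set_integral_eq_lebesgue_on unit_cube_sets_lebesgue cong: sum.cong)
qed

lemma sum_measure_partition:
  fixes P :: "(real ^ 'd) set set"
  assumes P: "measurable_partition P"
  shows "(\<Sum>\<Omega>\<in>P. measure lebesgue \<Omega>) = 1"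
proof -
  interpret finite_measure "lebesgue_on (unit_cube :: (real ^ 'd) set)"
    using unit_cube_lmeasurable by (rule finite_measure_lebesgue_on)
  have "(\<Sum>\<Omega>\<in>P. LINT x|lebesgue_on \<Omega>. 1 :: real) = (LINT x|lebesgue_on (unit_cube :: (real ^ 'd) set). 1)"
    using P by (rule sum_integral_partition) simp
  then show ?thesis
    using measurable_partitionD(1)[OF P]
    by (simp add: measure_restrict_space unit_cube_sets_lebesgue measure_unit_cube cong: sum.cong)
qed

context
  fixes g :: "real ^ 'd \<Rightarrow> real" and \<Omega> :: "(real ^ 'd) set" and P
  assumes g: "L2_on_cube g" and P: "measurable_partition P" and \<Omega>: "\<Omega> \<in> P"
begin

lemma stratum_mean_mult: "stratum_mean g \<Omega> * measure lebesgue \<Omega> = (LINT x|lebesgue_on \<Omega>. g x)"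
  using measurable_partitionD[OF P \<Omega>] by (simp add: stratum_mean_def set_integral_eq_lebesgue_on)

lemma stratum_integral_square_deviation:
  "(LINT x|lebesgue_on \<Omega>. (g x - c)\<^sup>2)
     = stratum_deviation g \<Omega> + (stratum_mean g \<Omega> - c)\<^sup>2 * measure lebesgue \<Omega>"
proof -
  note D = measurable_partitionD[OF P \<Omega>]
  interpret finite_measure "lebesgue_on \<Omega>" using D(5) by (rule finite_measure_lebesgue_on)
  have [simp]: "measure (lebesgue_on \<Omega>) \<Omega> = measure lebesgue \<Omega>"
    using D(1) by (simp add: measure_restrict_space)
  show ?thesis
    using integral_square_deviation_from_mean[OF L2_on_cube_subset[OF g D(1,3)],
        of "stratum_mean g \<Omega>" c] stratum_mean_mult
    by (simp add: stratum_deviation_def)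
qed

end

section \<open>The weighted standard deviations and the deviations of \<open>f\<close> and \<open>s\<close>\<close>

lemma noisy_second_moment:
  assumes "standardized M"
  shows "(LINT e|M. (a + b * e)\<^sup>2) = a\<^sup>2 + b\<^sup>2"
proof -
  interpret prob_space M using assms by (simp add: standardized_def)
  have "integrable M (\<lambda>e. e)" "integrable M (\<lambda>e. e\<^sup>2)" "expectation (\<lambda>e. e) = 0"
    "expectation (\<lambda>e. e\<^sup>2) = 1"
    using assms by (auto simp: standardized_def)
  moreover have "(a + b * e)\<^sup>2 = a\<^sup>2 + 2 * a * b * e + b\<^sup>2 * e\<^sup>2" for e
    by (simp add: power2_eq_square algebra_simps)
  ultimately show ?thesis by (simp add: prob_space)
qed

text \<open>Integrating out the noise leaves \<open>(f - \<mu>)\<^sup>2 + s\<^sup>2\<close>, where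
  \<open>\<mu>\<close> is the mean of \<open>f\<close>. Splitting the second moment of \<open>s\<close> as well
  isolates the squared mean of \<open>s\<close>, whose root times the weight is the integral of
  \<open>s\<close> over the stratum.\<close>

lemma stratum_variance_decomposition:
  assumes noise: "\<And>x. x \<in> unit_cube \<Longrightarrow> standardized (\<nu> x)"
    and f: "L2_on_cube f" and s: "L2_on_cube s"
    and P: "measurable_partition P" and \<Omega>: "\<Omega> \<in> P"
  shows "stratum_variance f s \<nu> \<Omega>
           = (stratum_mean s \<Omega>)\<^sup>2
             + (stratum_deviation f \<Omega> + stratum_deviation s \<Omega>) / measure lebesgue \<Omega>"
proof -
  note D = measurable_partitionD[OF P \<Omega>]
  interpret finite_measure "lebesgue_on \<Omega>" using D(5) by (rule finite_measure_lebesgue_on)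
  let ?\<mu> = "stratum_mean f \<Omega>"
  have "(LINT x:\<Omega>|lebesgue. LINT e|\<nu> x. (f x + s x * e - ?\<mu>)\<^sup>2)
      = (LINT x|lebesgue_on \<Omega>. LINT e|\<nu> x. (f x + s x * e - ?\<mu>)\<^sup>2)"
    using D(1) by (rule set_integral_eq_lebesgue_on)
  also have "\<dots> = (LINT x|lebesgue_on \<Omega>. (f x - ?\<mu>)\<^sup>2 + (s x)\<^sup>2)"
  proof (rule Bochner_Integration.integral_cong[OF refl])
    fix x assume "x \<in> space (lebesgue_on \<Omega>)"
    then have "standardized (\<nu> x)" using D(3) noise by auto
    from noisy_second_moment[OF this, of "f x - ?\<mu>" "s x"]
    show "(LINT e|\<nu> x. (f x + s x * e - ?\<mu>)\<^sup>2) = (f x - ?\<mu>)\<^sup>2 + (s x)\<^sup>2"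
      by (simp add: algebra_simps)
  qed
  also have "\<dots> = (LINT x|lebesgue_on \<Omega>. (f x - ?\<mu>)\<^sup>2) + (LINT x|lebesgue_on \<Omega>. (s x)\<^sup>2)"
    using L2_on_cube_subset[OF f D(1,3)] L2_on_cube_subset[OF s D(1,3)]
    by (intro Bochner_Integration.integral_add integrable_square_diff) auto
  also have "(LINT x|lebesgue_on \<Omega>. (s x)\<^sup>2)
      = stratum_deviation s \<Omega> + (stratum_mean s \<Omega>)\<^sup>2 * measure lebesgue \<Omega>"
    using stratum_integral_square_deviation[OF s P \<Omega>, of 0] by simp
  finally show ?thesis
    using D(2) by (simp add: stratum_variance_def stratum_deviation_def field_simps)
qed

lemma weighted_stratum_sd_bounds:
  assumes nonneg: "\<And>x. x \<in> unit_cube \<Longrightarrow> 0 \<le> s x"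
    and noise: "\<And>x. x \<in> unit_cube \<Longrightarrow> standardized (\<nu> x)"
    and f: "L2_on_cube f" and s: "L2_on_cube s"
    and P: "measurable_partition P" and \<Omega>: "\<Omega> \<in> P"
  defines "w \<equiv> measure lebesgue \<Omega>"
  shows "(LINT x|lebesgue_on \<Omega>. s x) \<le> w * sqrt (stratum_variance f s \<nu> \<Omega>)" (is ?lower)
    and "w * sqrt (stratum_variance f s \<nu> \<Omega>)
           \<le> (LINT x|lebesgue_on \<Omega>. s x)
              + sqrt w * sqrt (stratum_deviation f \<Omega> + stratum_deviation s \<Omega>)" (is ?upper)
proof -
  note D = measurable_partitionD[OF P \<Omega>]
  define m V where "m = stratum_mean s \<Omega>"
    and "V = stratum_deviation f \<Omega> + stratum_deviation s \<Omega>"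
  have w: "0 < w" using D(2) by (simp add: w_def)
  have V: "0 \<le> V" by (simp add: V_def stratum_deviation_nonneg)
  have var: "stratum_variance f s \<nu> \<Omega> = m\<^sup>2 + V / w"
    unfolding m_def V_def w_def using noise f s P \<Omega> by (rule stratum_variance_decomposition)
  have mw: "m * w = (LINT x|lebesgue_on \<Omega>. s x)"
    unfolding m_def w_def by (rule stratum_mean_mult[OF s P \<Omega>])
  have "0 \<le> (LINT x|lebesgue_on \<Omega>. s x)"
    using D(3) nonneg by (intro integral_nonneg_AE AE_I2) auto
  then have m: "0 \<le> m" using w by (simp add: zero_le_mult_iff flip: mw)
  have "m \<le> sqrt (m\<^sup>2 + V / w)" using V w by (intro real_le_rsqrt) simp
  then show ?lower unfolding var mw[symmetric] using w by (simp add: mult.commute)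
  have "sqrt (m\<^sup>2 + V / w) \<le> sqrt (m\<^sup>2) + sqrt (V / w)"
    using V w by (intro sqrt_add_le_add_sqrt) auto
  also have "\<dots> = m + sqrt V / sqrt w" using m by (simp add: real_sqrt_divide)
  finally have "w * sqrt (m\<^sup>2 + V / w) \<le> w * (m + sqrt V / sqrt w)" using w by simp
  also have "\<dots> = m * w + sqrt w * sqrt V"
    using w real_sqrt_mult_self[of w] by (simp add: field_simps)
  finally show ?upper unfolding var mw[symmetric] V_def .
qed

text \<open>The weights sum to 1, so Cauchy-Schwarz bounds the sum of
  \<open>sqrt w * sqrt V\<close> by the square root of the sum of the \<open>V\<close>, whatever the number of
  strata.\<close>

lemma Sigma_part_bounds:
  assumes nonneg: "\<And>x. x \<in> unit_cube \<Longrightarrow> 0 \<le> s x"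
    and noise: "\<And>x. x \<in> unit_cube \<Longrightarrow> standardized (\<nu> x)"
    and f: "L2_on_cube f" and s: "L2_on_cube s"
    and P: "measurable_partition P"
  shows "(LINT x|lebesgue_on unit_cube. s x) \<le> Sigma_part f s \<nu> P" (is ?lower)
    and "Sigma_part f s \<nu> P
           \<le> (LINT x|lebesgue_on unit_cube. s x)
              + sqrt ((\<Sum>\<Omega>\<in>P. stratum_deviation f \<Omega>) + (\<Sum>\<Omega>\<in>P. stratum_deviation s \<Omega>))"
      (is ?upper)
proof -
  note B = weighted_stratum_sd_bounds[OF nonneg noise f s P]
  let ?V = "\<lambda>\<Omega>. stratum_deviation f \<Omega> + stratum_deviation s \<Omega>"
  interpret finite_measure "lebesgue_on (unit_cube :: (real ^ 'd) set)"
    using unit_cube_lmeasurable by (rule finite_measure_lebesgue_on)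
  have "integrable (lebesgue_on unit_cube) s"
    using s square_integrable_imp_integrable unfolding L2_on_cube_def by blast
  note int = sum_integral_partition[OF P this]
  show ?lower
    unfolding int[symmetric] Sigma_part_def using B(1) by (intro sum_mono) auto
  have "(\<Sum>\<Omega>\<in>P. sqrt (measure lebesgue \<Omega>) * sqrt (?V \<Omega>))\<^sup>2
      \<le> (\<Sum>\<Omega>\<in>P. (sqrt (measure lebesgue \<Omega>))\<^sup>2) * (\<Sum>\<Omega>\<in>P. (sqrt (?V \<Omega>))\<^sup>2)"
    by (rule Cauchy_Schwarz_ineq_sum)
  also have "\<dots> = (\<Sum>\<Omega>\<in>P. ?V \<Omega>)"
    by (simp add: stratum_deviation_nonneg sum_measure_partition[OF P])
  finally have CS: "(\<Sum>\<Omega>\<in>P. sqrt (measure lebesgue \<Omega>) * sqrt (?V \<Omega>)) \<le> sqrt (\<Sum>\<Omega>\<in>P. ?V \<Omega>)"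
    by (rule real_le_rsqrt)
  have "Sigma_part f s \<nu> P
      \<le> (\<Sum>\<Omega>\<in>P. (LINT x|lebesgue_on \<Omega>. s x) + sqrt (measure lebesgue \<Omega>) * sqrt (?V \<Omega>))"
    unfolding Sigma_part_def using B(2) by (intro sum_mono) auto
  with CS int show ?upper by (simp add: sum.distrib)
qed

section \<open>Vanishing of the deviation under refinement\<close>

text \<open>On each stratum the mean of \<open>f\<close> does at least as well as the constant
  \<open>g y\<close>, for any point \<open>y\<close> of the stratum, and \<open>g\<close> stays within
  \<open>\<eta>\<close> of that constant.\<close>

lemma sum_stratum_deviation_le:
  fixes f g :: "real ^ 'd \<Rightarrow> real"
  assumes f: "L2_on_cube f" and g: "L2_on_cube g" and P: "measurable_partition P"
    and osc: "\<And>\<Omega> x y. \<Omega> \<in> P \<Longrightarrow> x \<in> \<Omega> \<Longrightarrow> y \<in> \<Omega> \<Longrightarrow> \<bar>g x - g y\<bar> \<le> \<eta>"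
  shows "(\<Sum>\<Omega>\<in>P. stratum_deviation f \<Omega>)
           \<le> 2 * (LINT x|lebesgue_on unit_cube. (f x - g x)\<^sup>2) + 2 * \<eta>\<^sup>2"
proof -
  have "stratum_deviation f \<Omega>
      \<le> 2 * (LINT x|lebesgue_on \<Omega>. (f x - g x)\<^sup>2) + 2 * \<eta>\<^sup>2 * measure lebesgue \<Omega>"
    if \<Omega>: "\<Omega> \<in> P" for \<Omega>
  proof -
    note D = measurable_partitionD[OF P \<Omega>]
    interpret finite_measure "lebesgue_on \<Omega>" using D(5) by (rule finite_measure_lebesgue_on)
    note f' = L2_on_cube_subset[OF f D(1,3)] and g' = L2_on_cube_subset[OF g D(1,3)]
    obtain y where y: "y \<in> \<Omega>" using D(4) by blast
    have fi: "integrable (lebesgue_on \<Omega>) (\<lambda>x. (f x - g y)\<^sup>2)"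
      and gi: "integrable (lebesgue_on \<Omega>) (\<lambda>x. (g x - g y)\<^sup>2)"
      and fgi: "integrable (lebesgue_on \<Omega>) (\<lambda>x. (f x - g x)\<^sup>2)"
      using f' g' by (auto intro!: integrable_square_diff)
    have "(g x - g y)\<^sup>2 \<le> \<eta>\<^sup>2" if "x \<in> \<Omega>" for x
      using osc[OF \<Omega> that y] by (intro abs_le_square_iff[THEN iffD1]) auto
    then have "(LINT x|lebesgue_on \<Omega>. (g x - g y)\<^sup>2) \<le> (LINT x|lebesgue_on \<Omega>. \<eta>\<^sup>2)"
      using gi by (intro integral_mono) auto
    also have "\<dots> = \<eta>\<^sup>2 * measure lebesgue \<Omega>"
      using D(1) by (simp add: measure_restrict_space)
    finally have "(LINT x|lebesgue_on \<Omega>. (g x - g y)\<^sup>2) \<le> \<eta>\<^sup>2 * measure lebesgue \<Omega>" .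
    moreover have "stratum_deviation f \<Omega> \<le> (LINT x|lebesgue_on \<Omega>. (f x - g y)\<^sup>2)"
      unfolding stratum_integral_square_deviation[OF f P \<Omega>] by simp
    ultimately show ?thesis
      using integral_square_diff_triangle[OF fgi gi fi] by simp
  qed
  then have "(\<Sum>\<Omega>\<in>P. stratum_deviation f \<Omega>)
      \<le> (\<Sum>\<Omega>\<in>P. 2 * (LINT x|lebesgue_on \<Omega>. (f x - g x)\<^sup>2) + 2 * \<eta>\<^sup>2 * measure lebesgue \<Omega>)"
    by (rule sum_mono)
  also have "\<dots> = 2 * (\<Sum>\<Omega>\<in>P. LINT x|lebesgue_on \<Omega>. (f x - g x)\<^sup>2)
      + 2 * \<eta>\<^sup>2 * (\<Sum>\<Omega>\<in>P. measure lebesgue \<Omega>)"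
    by (simp add: sum.distrib sum_distrib_left)
  also have "(\<Sum>\<Omega>\<in>P. LINT x|lebesgue_on \<Omega>. (f x - g x)\<^sup>2)
      = (LINT x|lebesgue_on unit_cube. (f x - g x)\<^sup>2)"
  proof (rule sum_integral_partition[OF P])
    interpret finite_measure "lebesgue_on (unit_cube :: (real ^ 'd) set)"
      using unit_cube_lmeasurable by (rule finite_measure_lebesgue_on)
    show "integrable (lebesgue_on unit_cube) (\<lambda>x. (f x - g x)\<^sup>2)"
      using f g by (intro integrable_square_diff) (auto simp: L2_on_cube_def)
  qed
  finally show ?thesis by (simp add: sum_measure_partition[OF P])
qed

lemma sum_stratum_deviation_tendsto_0:
  fixes f :: "real ^ 'd \<Rightarrow> real"
  assumes f: "L2_on_cube f" and P: "\<forall>\<^sub>F p in F. measurable_partition (\<N> p)"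
    and fine: "\<And>\<delta>. 0 < \<delta> \<Longrightarrow> \<forall>\<^sub>F p in F. \<forall>\<Omega>\<in>\<N> p. diameter \<Omega> < \<delta>"
  shows "((\<lambda>p. \<Sum>\<Omega>\<in>\<N> p. stratum_deviation f \<Omega>) \<longlongrightarrow> 0) F"
proof (rule tendstoI)
  fix \<epsilon> :: real assume "0 < \<epsilon>"
  \<comment> \<open>The approximation error and the squared oscillation both enter the bound with a factor
    2, hence \<open>\<epsilon> / 4\<close> for each.\<close>
  then have e4: "0 < \<epsilon> / 4" by simp
  obtain g where g: "continuous_on UNIV g" "integrable (lebesgue_on unit_cube) (\<lambda>x. (g x)\<^sup>2)"
    and fg: "(LINT x|lebesgue_on unit_cube. (f x - g x)\<^sup>2) < \<epsilon> / 4"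
    using continuous_approximation_L2[OF unit_cube_lmeasurable _ _ e4, of f] f
    unfolding L2_on_cube_def by blast
  have gc: "continuous_on unit_cube g" using g(1) continuous_on_subset by blast
  have gL2: "L2_on_cube g"
    using g(2) gc unit_cube_sets_lebesgue unfolding L2_on_cube_def
    by (blast intro: continuous_imp_measurable_on_sets_lebesgue)
  have "uniformly_continuous_on unit_cube g"
    using gc by (intro compact_uniformly_continuous) (simp_all add: unit_cube_def)
  then obtain \<delta> where "0 < \<delta>"
    and \<delta>: "\<And>x y. x \<in> unit_cube \<Longrightarrow> y \<in> unit_cube \<Longrightarrow> dist x y < \<delta> \<Longrightarrow> dist (g x) (g y) < sqrt (\<epsilon> / 4)"
    using e4 unfolding uniformly_continuous_on_def by (metis real_sqrt_gt_0_iff)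
  show "\<forall>\<^sub>F p in F. dist (\<Sum>\<Omega>\<in>\<N> p. stratum_deviation f \<Omega>) 0 < \<epsilon>"
    using P fine[OF \<open>0 < \<delta>\<close>]
  proof eventually_elim
    case (elim p)
    have "(\<Sum>\<Omega>\<in>\<N> p. stratum_deviation f \<Omega>)
        \<le> 2 * (LINT x|lebesgue_on unit_cube. (f x - g x)\<^sup>2) + 2 * (sqrt (\<epsilon> / 4))\<^sup>2"
    proof (rule sum_stratum_deviation_le[OF f gL2 elim(1)])
      fix \<Omega> x y assume \<Omega>: "\<Omega> \<in> \<N> p" and xy: "x \<in> \<Omega>" "y \<in> \<Omega>"
      note sub = measurable_partitionD(3)[OF elim(1) \<Omega>]
      have "bounded \<Omega>" using bounded_subset[OF _ sub] by (simp add: unit_cube_def)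
      then have "dist x y < \<delta>" using diameter_bounded_bound[OF _ xy] elim(2) \<Omega> by fastforce
      then show "\<bar>g x - g y\<bar> \<le> sqrt (\<epsilon> / 4)" using \<delta>[of x y] sub xy by (force simp: dist_real_def)
    qed
    also have "\<dots> < \<epsilon>" using fg e4 by simp
    finally show ?case by (simp add: dist_real_def sum_nonneg stratum_deviation_nonneg)
  qed
qed

section \<open>Convergence to the infimum\<close>

lemma cINF_eq_limit:
  fixes h :: "'a \<Rightarrow> real"
  assumes lower: "\<And>x. x \<in> A \<Longrightarrow> l \<le> h x" and X: "\<forall>\<^sub>F p in F. X p \<in> A"
    and lim: "((\<lambda>p. h (X p)) \<longlongrightarrow> l) F" and F: "F \<noteq> bot"
  shows "(INF x\<in>A. h x) = l"
proof (rule antisym)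
  have "A \<noteq> {}" using eventually_happens'[OF F X] by blast
  then show "l \<le> (INF x\<in>A. h x)" using lower by (intro cINF_greatest)
  have "bdd_below (h ` A)" using lower by (rule bdd_belowI2)
  then have "\<forall>\<^sub>F p in F. (INF x\<in>A. h x) \<le> h (X p)"
    using X by (auto elim!: eventually_mono intro: cINF_lower)
  then show "(INF x\<in>A. h x) \<le> l" using tendsto_lowerbound[OF lim _ F] by blast
qed

theorem proposition1:
  fixes f s :: "real ^ 'd \<Rightarrow> real"
    and \<nu> :: "real ^ 'd \<Rightarrow> real measure"
    and \<N> :: "nat \<Rightarrow> (real ^ 'd) set set"
    and \<upsilon> :: "nat \<Rightarrow> real"
    and D :: "real \<Rightarrow> real"
  assumes s_nonneg: "\<And>x. x \<in> unit_cube \<Longrightarrow> 0 \<le> s x"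
    and noise: "\<And>x. x \<in> unit_cube \<Longrightarrow> standardized (\<nu> x)"
    and partitions: "\<And>p. 1 \<le> p \<Longrightarrow> measurable_partition (\<N> p)"
    and AS1: "\<And>p \<Omega>. 1 \<le> p \<Longrightarrow> \<Omega> \<in> \<N> p \<Longrightarrow>
                0 < measure lebesgue \<Omega> \<and> measure lebesgue \<Omega> \<le> \<upsilon> p"
    and AS1_lim: "\<upsilon> \<longlonglongrightarrow> 0"
    and AS2: "\<And>p \<Omega>. 1 \<le> p \<Longrightarrow> \<Omega> \<in> \<N> p \<Longrightarrow> diameter \<Omega> \<le> D (measure lebesgue \<Omega>)"
    and AS2_lim: "(D \<longlongrightarrow> 0) (at_right 0)"
    and f_L2: "L2_on_cube f"
    and s_L2: "L2_on_cube s"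
  shows "(\<lambda>p. Sigma_part f s \<nu> (\<N> p)) \<longlonglongrightarrow> (LINT x:unit_cube|lebesgue. s x)
    \<and> (INF P\<in>{P. measurable_partition P}. Sigma_part f s \<nu> P) = (LINT x:unit_cube|lebesgue. s x)
    \<and> (\<forall>n\<ge>1. (\<lambda>p. real n * partition_quality f s \<nu> n (\<N> p)) \<longlonglongrightarrow> 0)"
proof -
  define I where "I = (LINT x:unit_cube|lebesgue. s x)"
  have I: "I = (LINT x|lebesgue_on unit_cube. s x)"
    by (simp add: I_def set_integral_eq_lebesgue_on unit_cube_sets_lebesgue)
  note bounds = Sigma_part_bounds[OF s_nonneg noise f_L2 s_L2, folded I]
  have "I \<ge> 0"
    unfolding I using s_nonneg by (intro integral_nonneg_AE AE_I2) auto
  have part: "\<forall>\<^sub>F p in sequentially. measurable_partition (\<N> p)"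
    using partitions by (rule eventually_sequentiallyI)
  have fine: "\<forall>\<^sub>F p in sequentially. \<forall>\<Omega>\<in>\<N> p. diameter \<Omega> < \<delta>" if "0 < \<delta>" for \<delta>
  proof -
    have "\<forall>\<^sub>F w in at_right 0. D w < \<delta>" using AS2_lim that by (rule order_tendstoD)
    then obtain r where r: "0 < r" "\<And>w. 0 < w \<Longrightarrow> w < r \<Longrightarrow> D w < \<delta>"
      by (auto simp: eventually_at_right_field)
    have "\<forall>\<^sub>F p in sequentially. \<upsilon> p < r" using AS1_lim r(1) by (rule order_tendstoD)
    then show ?thesis
      using eventually_ge_at_top[of 1]
    proof eventually_elim
      case (elim p)
      show ?case
      proof
        fix \<Omega> assume "\<Omega> \<in> \<N> p"
        then show "diameter \<Omega> < \<delta>"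
          using AS1[OF elim(2)] AS2[OF elim(2)] r(2)[of "measure lebesgue \<Omega>"] elim(1) by fastforce
      qed
    qed
  qed
  have lim: "(\<lambda>p. Sigma_part f s \<nu> (\<N> p)) \<longlonglongrightarrow> I"
  proof (rule tendsto_sandwich[OF _ _ tendsto_const])
    show "\<forall>\<^sub>F p in sequentially. I \<le> Sigma_part f s \<nu> (\<N> p)"
      using part by eventually_elim (rule bounds(1))
    show "\<forall>\<^sub>F p in sequentially. Sigma_part f s \<nu> (\<N> p) \<le>
        I + sqrt ((\<Sum>\<Omega>\<in>\<N> p. stratum_deviation f \<Omega>) + (\<Sum>\<Omega>\<in>\<N> p. stratum_deviation s \<Omega>))"
      using part by eventually_elim (rule bounds(2))
    have "(\<lambda>p. I + sqrt ((\<Sum>\<Omega>\<in>\<N> p. stratum_deviation f \<Omega>) + (\<Sum>\<Omega>\<in>\<N> p. stratum_deviation s \<Omega>)))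
        \<longlonglongrightarrow> I + sqrt (0 + 0)"
      using f_L2 s_L2 part fine by (intro tendsto_intros sum_stratum_deviation_tendsto_0)
    then show "(\<lambda>p. I + sqrt ((\<Sum>\<Omega>\<in>\<N> p. stratum_deviation f \<Omega>) + (\<Sum>\<Omega>\<in>\<N> p. stratum_deviation s \<Omega>)))
        \<longlonglongrightarrow> I" by simp
  qed
  have inf: "(INF P\<in>{P. measurable_partition P}. Sigma_part f s \<nu> P) = I"
    using bounds(1) part lim by (intro cINF_eq_limit[where X = \<N> and F = sequentially]) auto
  have "(\<lambda>p. real n * partition_quality f s \<nu> n (\<N> p)) \<longlonglongrightarrow> 0" if n: "1 \<le> n" for n
  proof -
    have risk: "(\<lambda>p. oracle_risk f s \<nu> n (\<N> p)) \<longlonglongrightarrow> I\<^sup>2 / real n"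
      unfolding oracle_risk_def using lim n by (intro tendsto_intros) auto
    have "(INF P\<in>{P. measurable_partition P}. oracle_risk f s \<nu> n P) = I\<^sup>2 / real n"
    proof (rule cINF_eq_limit[where X = \<N> and F = sequentially])
      fix P :: "(real ^ 'd) set set" assume "P \<in> {P. measurable_partition P}"
      then show "I\<^sup>2 / real n \<le> oracle_risk f s \<nu> n P"
        unfolding oracle_risk_def using bounds(1) \<open>I \<ge> 0\<close>
        by (intro divide_right_mono power_mono) auto
    qed (use part risk in auto)
    moreover have "(\<lambda>p. real n * (oracle_risk f s \<nu> n (\<N> p) - I\<^sup>2 / real n))
        \<longlonglongrightarrow> real n * (I\<^sup>2 / real n - I\<^sup>2 / real n)"
      using risk by (intro tendsto_intros)
    ultimately show ?thesis by (simp add: partition_quality_def)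
  qed
  with lim inf show ?thesis unfolding I_def by blast
qed

end
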